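(* Let $H$ be a separable Hilbert space and let $\{x_k\}_{k=1}^\infty$ be a complete minimal system of vectors in $H$. For $\sigma\subset\mathbb{N}$ let $H_\sigma$ be the closed linear span of $\{x_k\}_{k\in\sigma}$, let $P_\sigma$ be the orthogonal projector onto $H_\sigma$, and for $m\in\mathbb{N}$ put $\sigma_m=\sigma\cup\{n\in\mathbb{N}: n\ge m+1\}$. Then the following are equivalent: (i) the system $\{x_k\}_{k=1}^\infty$ is hereditarily complete; (ii) $\bigcap_{m=1}^\infty H_{\sigma_m}=H_\sigma$ for every subset $\sigma\subset\mathbb{N}$; (iii) for every subset $\sigma\subset\mathbb{N}$, $P_{\sigma_m}\to P_\sigma$ pointwise as $m\to\infty$ (that is, $P_{\sigma_m}x\to P_\sigma x$ in norm for each $x\in H$).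
   Context: A system $\{x_k\}_{k=1}^\infty$ in $H$ is complete if its closed linear span is $H$; it is minimal if for every $k$ the vector $x_k$ does not lie in the closed linear span of $\{x_j\}_{j\ne k}$. Minimality is equivalent to the existence of a biorthogonal system $\{x_k^*\}_{k=1}^\infty\subset H$, i.e. $(x_k,x_j^* )=\delta_{k,j}$; if the system is complete, the biorthogonal system is unique. A complete system $\{x_k\}_{k=1}^\infty$ is hereditarily complete if it is minimal and for each $x\in H$ the vector $x$ belongs to the closed linear span of $\{(x,x_k^* )x_k\}_{k=1}^\infty$. *)

theory Defs
  imports "HOL-Analysis.Analysis"
begin

(* Scalar fields: the norm identity makes every element a root of a real quadratic,
   so the only models are the real and the complex numbers. *)
class real_or_complex = real_normed_field +
  fixes conjugate :: "'a \<Rightarrow> 'a"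
  assumes conjugate_add: "conjugate (a + b) = conjugate a + conjugate b"
    and conjugate_mult: "conjugate (a * b) = conjugate a * conjugate b"
    and conjugate_real_multiple: "conjugate (r *\<^sub>R 1) = r *\<^sub>R 1"
    and mult_conjugate: "a * conjugate a = (norm a)\<^sup>2 *\<^sub>R 1"

instantiation real :: real_or_complex
begin

definition conjugate_real :: "real \<Rightarrow> real" where
  "conjugate_real a = a"

instance
  by standard (simp_all add: conjugate_real_def power2_eq_square)

end

instantiation complex :: real_or_complex
begin

definition conjugate_complex :: "complex \<Rightarrow> complex" where
  "conjugate_complex = cnj"

instance
  by standard (simp_all add: conjugate_complex_def scaleR_conv_of_real complex_norm_square del: of_real_power)

end

(* The space is the whole type 'h; completeness comes from the class banach.  The inner
   product is linear in its first argument and induces the norm of the class. *)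
locale hilbert_space = vector_space smul
  for smul :: "'k::real_or_complex \<Rightarrow> 'h::banach \<Rightarrow> 'h" +
  fixes ip :: "'h \<Rightarrow> 'h \<Rightarrow> 'k"
  assumes smul_of_real: "smul (of_real r) u = r *\<^sub>R u"
    and ip_add_left: "ip (u + v) w = ip u w + ip v w"
    and ip_smul_left: "ip (smul a u) v = a * ip u v"
    and ip_conjugate: "ip v u = conjugate (ip u v)"
    and ip_self: "ip u u = of_real ((norm u)\<^sup>2)"

lemma hilbert_space_real:
  "hilbert_space scaleR (inner :: 'h::{real_inner, banach} \<Rightarrow> 'h \<Rightarrow> real)"
  by unfold_locales
    (simp_all add: algebra_simps inner_add_left conjugate_real_def inner_commute
      power2_norm_eq_inner)

lemma hilbert_space_complex:
  "hilbert_space (*) (\<lambda>u v :: complex. u * cnj v)"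
  by unfold_locales
    (simp_all add: algebra_simps conjugate_complex_def scaleR_conv_of_real complex_norm_square
      del: of_real_power)

definition closed_span :: "('k::real_or_complex \<Rightarrow> 'h::banach \<Rightarrow> 'h) \<Rightarrow> 'h set \<Rightarrow> 'h set" where
  "closed_span smul S = closure (module.span smul S)"

(* Systems are indexed by the positive integers: the value x 0 is never used. *)
definition complete_system ::
    "('k::real_or_complex \<Rightarrow> 'h::banach \<Rightarrow> 'h) \<Rightarrow> (nat \<Rightarrow> 'h) \<Rightarrow> bool" where
  "complete_system smul x \<longleftrightarrow> closed_span smul (x ` {1..}) = UNIV"

definition minimal_system ::
    "('k::real_or_complex \<Rightarrow> 'h::banach \<Rightarrow> 'h) \<Rightarrow> (nat \<Rightarrow> 'h) \<Rightarrow> bool" where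
  "minimal_system smul x \<longleftrightarrow> (\<forall>k\<ge>1. x k \<notin> closed_span smul (x ` ({1..} - {k})))"

definition biorthogonal ::
    "('h::banach \<Rightarrow> 'h \<Rightarrow> 'k::real_or_complex) \<Rightarrow> (nat \<Rightarrow> 'h) \<Rightarrow> (nat \<Rightarrow> 'h) \<Rightarrow> bool" where
  "biorthogonal ip x y \<longleftrightarrow> (\<forall>k\<ge>1. \<forall>j\<ge>1. ip (x k) (y j) = (if k = j then 1 else 0))"

(* For a complete minimal system the biorthogonal system exists and is unique, so the
   existential quantifier only names it. *)
definition hereditarily_complete ::
    "('k::real_or_complex \<Rightarrow> 'h::banach \<Rightarrow> 'h) \<Rightarrow> ('h \<Rightarrow> 'h \<Rightarrow> 'k) \<Rightarrow> (nat \<Rightarrow> 'h) \<Rightarrow> bool" where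
  "hereditarily_complete smul ip x \<longleftrightarrow>
     complete_system smul x \<and> minimal_system smul x \<and>
     (\<exists>y. biorthogonal ip x y \<and>
        (\<forall>u. u \<in> closed_span smul ((\<lambda>k. smul (ip u (y k)) (x k)) ` {1..})))"

definition orth_projector ::
    "('h::banach \<Rightarrow> 'h \<Rightarrow> 'k::real_or_complex) \<Rightarrow> 'h set \<Rightarrow> 'h \<Rightarrow> 'h" where
  "orth_projector ip M u = (THE v. v \<in> M \<and> (\<forall>w\<in>M. ip (u - v) w = 0))"

definition subsystem_span ::
    "('k::real_or_complex \<Rightarrow> 'h::banach \<Rightarrow> 'h) \<Rightarrow> (nat \<Rightarrow> 'h) \<Rightarrow> nat set \<Rightarrow> 'h set" where
  "subsystem_span smul x \<sigma> = closed_span smul (x ` \<sigma>)"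

definition with_tail :: "nat set \<Rightarrow> nat \<Rightarrow> nat set" where
  "with_tail \<sigma> m = \<sigma> \<union> {n. n \<ge> m + 1}"

end

theory Submission imports Defs begin

text \<open>
  If \<open>y\<close> is biorthogonal to \<open>x\<close>, a vector of \<open>\<Inter>\<^sub>m H\<^bsub>\<sigma>\<^sub>m\<^esub>\<close> has vanishing coefficients
  outside \<open>\<sigma>\<close>, so hereditary completeness puts it into \<open>H\<^bsub>\<sigma>\<^esub>\<close>.  Conversely, let \<open>\<sigma>\<close> be the
  set of nonzero coefficients of \<open>u\<close>.  For each \<open>m\<close> the continuous map
  \<open>v \<mapsto> v - \<Sum>\<^bsub>k \<le> m, k \<notin> \<sigma>\<^esub> (v, y\<^sub>k) x\<^sub>k\<close> fixes \<open>u\<close> and sends the linear span of all \<open>x\<^sub>k\<close> into that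
  of \<open>\<sigma>\<^sub>m\<close>, so \<open>u\<close> lies in every \<open>H\<^bsub>\<sigma>\<^sub>m\<^esub>\<close>.  Finally, projectors onto a decreasing sequence of closed
  subspaces always converge pointwise to the projector onto the intersection.
\<close>

section \<open>Scalars and inner product identities\<close>

lemma conjugate_zero [simp]: "conjugate (0 :: 'k::real_or_complex) = 0"
  using conjugate_real_multiple[of 0] by simp

lemma conjugate_of_real [simp]: "conjugate (of_real r :: 'k::real_or_complex) = of_real r"
  using conjugate_real_multiple[of r] by (simp add: scaleR_conv_of_real)

lemma mult_conjugate_of_real:
  "a * conjugate a = (of_real ((norm a)\<^sup>2) :: 'k::real_or_complex)"
  using mult_conjugate[of a] by (simp add: scaleR_conv_of_real)

context hilbert_space
begin

lemma ip_add_right: "ip u (v + w) = ip u v + ip u w"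
  by (metis ip_conjugate ip_add_left conjugate_add)

lemma ip_smul_right: "ip u (smul a v) = conjugate a * ip u v"
  by (metis ip_conjugate ip_smul_left conjugate_mult)

lemma ip_zero_left [simp]: "ip 0 v = 0"
  using ip_add_left[of 0 0 v] by simp

lemma ip_zero_right [simp]: "ip v 0 = 0"
  by (metis ip_conjugate ip_zero_left conjugate_zero)

lemma ip_diff_left: "ip (u - v) w = ip u w - ip v w"
  using ip_add_left[of "u - v" v w] by simp

lemma ip_diff_right: "ip w (u - v) = ip w u - ip w v"
  using ip_add_right[of w "u - v" v] by simp

lemma ip_eq_zero_commute: "ip u v = 0 \<Longrightarrow> ip v u = 0"
  by (metis ip_conjugate conjugate_zero)

text \<open>The class gives homogeneity of the norm for real multiples. For general scalars it comes
  from pulling \<open>a\<close> and \<open>conjugate a\<close> out of the inner product, whose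
  product is the squared modulus.\<close>

lemma norm_smul: "norm (smul a u) = norm a * norm u"
proof -
  have "of_real ((norm (smul a u))\<^sup>2) = (a * conjugate a) * ip u u"
    unfolding ip_self[symmetric] by (simp add: ip_smul_left ip_smul_right)
  also have "\<dots> = of_real ((norm a * norm u)\<^sup>2)"
    by (simp add: mult_conjugate_of_real ip_self power_mult_distrib)
  finally have "(norm (smul a u))\<^sup>2 = (norm a * norm u)\<^sup>2"
    using of_real_eq_iff by blast
  then show ?thesis
    by (simp add: power2_eq_iff_nonneg)
qed

lemma pythagoras:
  assumes "ip u v = 0"
  shows "(norm (u + v))\<^sup>2 = (norm u)\<^sup>2 + (norm v)\<^sup>2"
proof -
  have "of_real ((norm (u + v))\<^sup>2) = ip u u + ip v v"
    unfolding ip_self[symmetric] using assms ip_eq_zero_commute[OF assms]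
    by (simp add: ip_add_left ip_add_right)
  also have "\<dots> = of_real ((norm u)\<^sup>2 + (norm v)\<^sup>2)"
    by (simp add: ip_self)
  finally show ?thesis
    using of_real_eq_iff by blast
qed

lemma parallelogram:
  fixes u v :: 'h
  shows "(norm (u + v))\<^sup>2 + (norm (u - v))\<^sup>2 = 2 * (norm u)\<^sup>2 + 2 * (norm v)\<^sup>2"
proof -
  have "of_real ((norm (u + v))\<^sup>2 + (norm (u - v))\<^sup>2) = 2 * ip u u + 2 * ip v v"
    unfolding of_real_add ip_self[symmetric]
    by (simp add: ip_add_left ip_add_right ip_diff_left ip_diff_right)
  also have "\<dots> = of_real (2 * (norm u)\<^sup>2 + 2 * (norm v)\<^sup>2)"
    by (simp add: ip_self)
  finally show ?thesis
    using of_real_eq_iff by blast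
qed

text \<open>The coefficient makes the remainder orthogonal to \<open>v\<close>, so Pythagoras
  applies. Nonnegativity of the left side yields Cauchy-Schwarz, and the exact loss of length yields
  orthogonality at a nearest point.\<close>

lemma norm_diff_component:
  assumes "v \<noteq> 0"
  shows "(norm (u - smul (ip u v / of_real ((norm v)\<^sup>2)) v))\<^sup>2
    = (norm u)\<^sup>2 - (norm (ip u v))\<^sup>2 / (norm v)\<^sup>2"
proof -
  define c where "c = ip u v / of_real ((norm v)\<^sup>2)"
  have "ip (u - smul c v) (smul c v) = 0"
    using assms by (simp add: ip_smul_right ip_diff_left ip_smul_left ip_self c_def)
  from pythagoras[OF this]
  have "(norm u)\<^sup>2 = (norm (u - smul c v))\<^sup>2 + (norm (smul c v))\<^sup>2"
    by simp
  moreover have "(norm (smul c v))\<^sup>2 = (norm (ip u v))\<^sup>2 / (norm v)\<^sup>2"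
    using assms
    by (simp add: norm_smul c_def norm_divide norm_mult power2_eq_square)
  ultimately show ?thesis
    by (simp add: c_def)
qed

lemma cauchy_schwarz: "norm (ip u v) \<le> norm u * norm v"
proof (cases "v = 0")
  case False
  have "0 \<le> (norm u)\<^sup>2 - (norm (ip u v))\<^sup>2 / (norm v)\<^sup>2"
    unfolding norm_diff_component[OF False, symmetric] by simp
  then have "(norm (ip u v))\<^sup>2 \<le> (norm u * norm v)\<^sup>2"
    using False by (simp add: field_simps power_mult_distrib)
  then show ?thesis
    by (rule power2_le_imp_le) simp
qed simp

section \<open>Continuity of the operations and closed linear spans\<close>

lemma bounded_linear_ip_left: "bounded_linear (\<lambda>u. ip u w)"
proof (rule bounded_linear_intro[where K = "norm w"])
  show "ip (r *\<^sub>R u) w = r *\<^sub>R ip u w" for r u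
    unfolding smul_of_real[symmetric] by (simp add: ip_smul_left scaleR_conv_of_real)
qed (simp_all add: ip_add_left cauchy_schwarz)

lemma bounded_linear_smul: "bounded_linear (smul a)"
proof (rule bounded_linear_intro[where K = "norm a"])
  show "smul a (r *\<^sub>R u) = r *\<^sub>R smul a u" for r u
    unfolding smul_of_real[symmetric] by (simp add: mult.commute)
qed (simp_all add: scale_right_distrib norm_smul mult.commute)

lemma bounded_linear_smul_left: "bounded_linear (\<lambda>a. smul a u)"
proof (rule bounded_linear_intro[where K = "norm u"])
  show "smul (r *\<^sub>R a) u = r *\<^sub>R smul a u" for r a
    unfolding smul_of_real[symmetric] by (simp add: scaleR_conv_of_real)
qed (simp_all add: scale_left_distrib norm_smul)

text \<open>Addition and every \<open>smul c\<close> are continuous, so both pass to limits of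
  sequences from \<open>S\<close>.\<close>

lemma subspace_closure:
  assumes "subspace S"
  shows "subspace (closure S)"
proof (rule subspaceI)
  show "0 \<in> closure S"
    using subspace_0[OF assms] closure_subset by blast
next
  fix u v assume "u \<in> closure S" "v \<in> closure S"
  then obtain f g where f: "\<forall>n. f n \<in> S" "f \<longlonglongrightarrow> u" and g: "\<forall>n. g n \<in> S" "g \<longlonglongrightarrow> v"
    unfolding closure_sequential by blast
  have "(\<lambda>n. f n + g n) \<longlonglongrightarrow> u + v"
    using f g by (intro tendsto_add)
  moreover have "\<forall>n. f n + g n \<in> S"
    using f g subspace_add[OF assms] by blast
  ultimately show "u + v \<in> closure S"
    unfolding closure_sequential by (intro exI[of _ "\<lambda>n. f n + g n"] conjI)
next
  fix c u assume "u \<in> closure S"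
  then obtain f where f: "\<forall>n. f n \<in> S" "f \<longlonglongrightarrow> u"
    unfolding closure_sequential by blast
  have "(\<lambda>n. smul c (f n)) \<longlonglongrightarrow> smul c u"
    by (rule bounded_linear.tendsto[OF bounded_linear_smul f(2)])
  moreover have "\<forall>n. smul c (f n) \<in> S"
    using f subspace_scale[OF assms] by blast
  ultimately show "smul c u \<in> closure S"
    unfolding closure_sequential by (intro exI[of _ "\<lambda>n. smul c (f n)"] conjI)
qed

lemma subspace_closed_span: "subspace (closed_span smul S)"
  unfolding closed_span_def by (rule subspace_closure) simp

lemma closed_closed_span: "closed (closed_span smul S)"
  unfolding closed_span_def by simp

lemma closed_span_base: "a \<in> S \<Longrightarrow> a \<in> closed_span smul S"
  unfolding closed_span_def using span_base closure_subset by blast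

lemma closed_span_minimal:
  assumes "S \<subseteq> T" "subspace T" "closed T"
  shows "closed_span smul S \<subseteq> T"
  unfolding closed_span_def using assms by (intro closure_minimal span_minimal)

lemma closed_span_mono: "S \<subseteq> T \<Longrightarrow> closed_span smul S \<subseteq> closed_span smul T"
  unfolding closed_span_def by (intro closure_mono span_mono)

lemma subspace_orthogonal: "subspace {u. ip u w = 0}"
  by (auto simp: subspace_def ip_add_left ip_smul_left)

lemma closed_orthogonal: "closed {u. ip u w = 0}"
  by (intro closed_Collect_eq continuous_intros
      bounded_linear.continuous_on[OF bounded_linear_ip_left])

section \<open>Orthogonal projection onto a closed subspace\<close>

text \<open>A minimizing sequence is Cauchy by the parallelogram law, because midpoints of its terms
  stay in \<open>M\<close> and cannot be closer to \<open>u\<close> than the infimum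
  \<open>d\<close>. Its limit attains the minimum.\<close>

lemma subspace_nearest_point:
  assumes "subspace M" "closed M"
  obtains p where "p \<in> M" "\<And>w. w \<in> M \<Longrightarrow> dist u p \<le> dist u w"
proof -
  have ne: "M \<noteq> {}"
    using subspace_0[OF assms(1)] by blast
  define d where "d = infdist u M"
  have d_le: "d \<le> norm (u - w)" if "w \<in> M" for w
    using infdist_le[OF that, of u] by (simp add: d_def dist_norm)
  have d0: "0 \<le> d"
    by (simp add: d_def infdist_nonneg)
  have "\<exists>w\<in>M. norm (u - w) < d + inverse (real (Suc n))" for n
  proof -
    have "(INF w\<in>M. dist u w) < d + inverse (real (Suc n))"
      using ne by (simp add: d_def infdist_def)
    moreover have "bdd_below (dist u ` M)"
      by (rule bdd_belowI[of _ 0]) auto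
    ultimately show ?thesis
      using ne by (simp add: cINF_less_iff dist_norm)
  qed
  then obtain w where wM: "\<And>n. w n \<in> M"
    and w_less: "\<And>n. norm (u - w n) < d + inverse (real (Suc n))"
    by metis
  have w_lim: "(\<lambda>n. norm (u - w n)) \<longlonglongrightarrow> d"
    by (rule tendsto_sandwich[OF _ _ tendsto_const LIMSEQ_inverse_real_of_nat_add])
      (use d_le[OF wM] less_imp_le[OF w_less] in simp_all)
  \<comment> \<open>Apply the parallelogram law to \<open>u - w m\<close> and
    \<open>u - w n\<close>: their sum is twice the difference of \<open>u\<close> and a midpoint,
    hence has norm at least \<open>2 * d\<close>.\<close>
  have diff_le: "(dist (w m) (w n))\<^sup>2 \<le> 2 * ((norm (u - w m))\<^sup>2 - d\<^sup>2) + 2 * ((norm (u - w n))\<^sup>2 - d\<^sup>2)"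
    for m n
  proof -
    have mid: "(1/2) *\<^sub>R (w m + w n) \<in> M"
      unfolding smul_of_real[symmetric]
      using wM by (intro subspace_scale subspace_add assms)
    have "(u - w m) + (u - w n) = 2 *\<^sub>R (u - (1/2) *\<^sub>R (w m + w n))"
      by (simp add: algebra_simps scaleR_2)
    then have "norm ((u - w m) + (u - w n)) = 2 * norm (u - (1/2) *\<^sub>R (w m + w n))"
      by (metis norm_scaleR abs_numeral)
    then have "2 * d \<le> norm ((u - w m) + (u - w n))"
      using d_le[OF mid] by simp
    then have "(2 * d)\<^sup>2 \<le> (norm ((u - w m) + (u - w n)))\<^sup>2"
      using d0 by (intro power_mono) auto
    moreover have "norm ((u - w m) - (u - w n)) = dist (w m) (w n)"
      by (simp add: dist_norm norm_minus_commute)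
    ultimately show ?thesis
      using parallelogram[of "u - w m" "u - w n"] by (simp add: power_mult_distrib)
  qed
  have "Cauchy w"
  proof (rule metric_CauchyI)
    fix e :: real assume e: "0 < e"
    have "(\<lambda>n. (norm (u - w n))\<^sup>2 - d\<^sup>2) \<longlonglongrightarrow> d\<^sup>2 - d\<^sup>2"
      by (intro tendsto_intros w_lim)
    then have "\<forall>\<^sub>F n in sequentially. (norm (u - w n))\<^sup>2 - d\<^sup>2 < e\<^sup>2 / 4"
      by (rule order_tendstoD(2)) (use e in simp)
    then obtain N where N: "\<And>n. n \<ge> N \<Longrightarrow> (norm (u - w n))\<^sup>2 - d\<^sup>2 < e\<^sup>2 / 4"
      unfolding eventually_sequentially by blast
    have "dist (w m) (w n) < e" if "m \<ge> N" "n \<ge> N" for m n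
    proof (rule power2_less_imp_less)
      show "(dist (w m) (w n))\<^sup>2 < e\<^sup>2"
        using diff_le[of m n] N[OF that(1)] N[OF that(2)] by simp
    qed (use e in simp)
    then show "\<exists>N. \<forall>m\<ge>N. \<forall>n\<ge>N. dist (w m) (w n) < e"
      by blast
  qed
  then obtain p where p: "w \<longlonglongrightarrow> p"
    using Cauchy_convergent convergent_def by blast
  have "(\<lambda>n. norm (u - w n)) \<longlonglongrightarrow> norm (u - p)"
    by (intro tendsto_intros p)
  then have "norm (u - p) = d"
    using w_lim LIMSEQ_unique by blast
  then show thesis
    using that[of p] closed_sequentially[OF assms(2) _ p] wM d_le by (simp add: dist_norm)
qed

text \<open>Take the nearest point \<open>p\<close>. If \<open>u - p\<close> had a nonzero component
  along some \<open>w\<close> in \<open>M\<close>, moving \<open>p\<close> by that component would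
  bring it strictly closer to \<open>u\<close>.\<close>

lemma orthogonal_decomposition:
  assumes "subspace M" "closed M"
  obtains p where "p \<in> M" "\<And>w. w \<in> M \<Longrightarrow> ip (u - p) w = 0"
proof -
  obtain p where p: "p \<in> M" and min: "\<And>w. w \<in> M \<Longrightarrow> dist u p \<le> dist u w"
    using subspace_nearest_point[OF assms] by metis
  have "ip (u - p) w = 0" if w: "w \<in> M" for w
  proof (cases "w = 0")
    case False
    define v where "v = smul (ip (u - p) w / of_real ((norm w)\<^sup>2)) w"
    have "p + v \<in> M"
      unfolding v_def by (intro subspace_add subspace_scale assms p w)
    from min[OF this] have "norm (u - p) \<le> norm ((u - p) - v)"
      by (simp add: dist_norm algebra_simps)
    then have "(norm (u - p))\<^sup>2 \<le> (norm ((u - p) - v))\<^sup>2"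
      by (intro power_mono) auto
    then have "(norm (ip (u - p) w))\<^sup>2 / (norm w)\<^sup>2 \<le> 0"
      unfolding v_def norm_diff_component[OF False] by simp
    then show ?thesis
      using False by (simp add: divide_le_0_iff)
  qed simp
  with p show thesis
    using that by blast
qed

text \<open>Settles the uniqueness behind the definite description in \<open>orth_projector\<close>,
  so that any vector with the two defining properties can be substituted for it.\<close>

lemma orth_projector_eq:
  assumes "subspace M" "p \<in> M" "\<And>w. w \<in> M \<Longrightarrow> ip (u - p) w = 0"
  shows "orth_projector ip M u = p"
  unfolding orth_projector_def
proof (rule the_equality)
  fix v assume v: "v \<in> M \<and> (\<forall>w\<in>M. ip (u - v) w = 0)"
  then have "p - v \<in> M"
    using assms(1,2) subspace_diff by blast
  \<comment> \<open>Both residuals are orthogonal to \<open>p - v\<close>, and they differ by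
    \<open>p - v\<close> itself, which is therefore zero.\<close>
  then have "ip (u - v) (p - v) - ip (u - p) (p - v) = 0"
    using v assms(3) by simp
  then have "ip (p - v) (p - v) = 0"
    by (simp add: ip_diff_left)
  then show "v = p"
    by (simp add: ip_self)
qed (use assms in blast)

lemma orth_projector_works:
  assumes "subspace M" "closed M"
  shows orth_projector_in: "orth_projector ip M u \<in> M"
    and orth_projector_orthogonal: "w \<in> M \<Longrightarrow> ip (u - orth_projector ip M u) w = 0"
proof -
  obtain p where "p \<in> M" "\<And>w. w \<in> M \<Longrightarrow> ip (u - p) w = 0"
    using orthogonal_decomposition[OF assms] by metis
  then show "orth_projector ip M u \<in> M"
    and "w \<in> M \<Longrightarrow> ip (u - orth_projector ip M u) w = 0"
    using orth_projector_eq[OF assms(1)] by simp_all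
qed

lemma orth_projector_fixed: "subspace M \<Longrightarrow> u \<in> M \<Longrightarrow> orth_projector ip M u = u"
  by (rule orth_projector_eq) simp_all

text \<open>The squared distances from \<open>u\<close> to the subspaces increase and are bounded,
  hence converge. By Pythagoras their gaps are the squared distances between projections, so the
  projections form a Cauchy sequence, and the limit has the defining properties of the projection
  onto the intersection.\<close>

lemma orth_projector_decseq_tendsto:
  fixes M :: "nat \<Rightarrow> 'h set"
  assumes sub: "\<And>m. subspace (M m)" and cl: "\<And>m. closed (M m)" and dec: "decseq M"
  shows "(\<lambda>m. orth_projector ip (M m) u) \<longlonglongrightarrow> orth_projector ip (\<Inter>m. M m) u"
proof -
  define p where "p m = orth_projector ip (M m) u" for m
  define a where "a m = (norm (u - p m))\<^sup>2" for m
  have p_in: "p m \<in> M n" if "n \<le> m" for m n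
    using orth_projector_in[OF sub cl] decseqD[OF dec that] by (auto simp: p_def)
  have p_orth: "ip (u - p m) w = 0" if "w \<in> M m" for m w
    using orth_projector_orthogonal[OF sub cl that] by (simp add: p_def)
  \<comment> \<open>Split \<open>u - p n\<close> as \<open>(u - p m) + (p m - p n)\<close>. The
    second summand lies in \<open>M m\<close> because \<open>M n\<close> is contained in it.\<close>
  have a_diff: "a n = a m + (norm (p m - p n))\<^sup>2" if "m \<le> n" for m n
  proof -
    have "ip (u - p m) (p m - p n) = 0"
      using p_in[OF that] p_in[OF order_refl] by (intro p_orth subspace_diff sub)
    from pythagoras[OF this] show ?thesis
      by (simp add: a_def)
  qed
  have a_le: "a n \<le> (norm u)\<^sup>2" for n
  proof -
    have "ip (u - p n) (p n) = 0"
      using p_in by (intro p_orth) simp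
    from pythagoras[OF this] show ?thesis
      by (simp add: a_def)
  qed
  have "incseq a"
    using a_diff by (auto simp: incseq_def)
  then obtain l where "a \<longlonglongrightarrow> l"
    using a_le incseq_convergent by metis
  then have "Cauchy a"
    by (rule LIMSEQ_imp_Cauchy)
  have "Cauchy p"
  proof (rule metric_CauchyI)
    fix e :: real assume e: "0 < e"
    then obtain N where N: "\<And>m n. m \<ge> N \<Longrightarrow> n \<ge> N \<Longrightarrow> dist (a m) (a n) < e\<^sup>2"
      using metric_CauchyD[OF \<open>Cauchy a\<close>, of "e\<^sup>2"] by auto
    have "dist (p m) (p n) < e" if "m \<ge> N" "n \<ge> N" for m n
    proof (rule power2_less_imp_less)
      have "(dist (p m) (p n))\<^sup>2 = dist (a m) (a n)"
        using a_diff[of m n] a_diff[of n m]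
        by (cases "m \<le> n") (auto simp: dist_norm norm_minus_commute)
      then show "(dist (p m) (p n))\<^sup>2 < e\<^sup>2"
        using N[OF that] by simp
    qed (use e in simp)
    then show "\<exists>N. \<forall>m\<ge>N. \<forall>n\<ge>N. dist (p m) (p n) < e"
      by blast
  qed
  then obtain q where q: "p \<longlonglongrightarrow> q"
    using Cauchy_convergent convergent_def by blast
  \<comment> \<open>From index \<open>n\<close> on the sequence stays in the closed set
    \<open>M n\<close>.\<close>
  have q_in: "q \<in> M n" for n
    by (rule Lim_in_closed_set[OF cl _ _ q])
      (use p_in in \<open>auto simp: eventually_sequentially\<close>)
  have q_orth: "ip (u - q) w = 0" if "w \<in> (\<Inter>m. M m)" for w
  proof -
    have "(\<lambda>m. ip (u - p m) w) \<longlonglongrightarrow> ip (u - q) w"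
      by (intro bounded_linear.tendsto[OF bounded_linear_ip_left] tendsto_intros q)
    moreover have "ip (u - p m) w = 0" for m
      using that by (intro p_orth) blast
    ultimately show ?thesis
      by (simp add: LIMSEQ_const_iff)
  qed
  have "orth_projector ip (\<Inter>m. M m) u = q"
    using q_in q_orth sub by (intro orth_projector_eq subspace_Inter) auto
  with q show ?thesis
    unfolding p_def by simp
qed

section \<open>Biorthogonal systems and vanishing coefficients\<close>

text \<open>Projecting \<open>x k\<close> onto the closed span of the other vectors leaves a
  residual \<open>e\<close>, nonzero by minimality and orthogonal to all the others. A suitable
  multiple of it serves as \<open>y k\<close>.\<close>

lemma biorthogonal_exists:
  assumes "minimal_system smul x"
  obtains y where "biorthogonal ip x y"
proof -
  have "\<exists>z. ip (x k) z = 1 \<and> (\<forall>j\<ge>1. j \<noteq> k \<longrightarrow> ip (x j) z = 0)" if k: "k \<ge> 1" for k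
  proof -
    define M where "M = closed_span smul (x ` ({1..} - {k}))"
    obtain p where p: "p \<in> M" and orth: "\<And>w. w \<in> M \<Longrightarrow> ip (x k - p) w = 0"
      using orthogonal_decomposition[of M "x k"] subspace_closed_span closed_closed_span
      unfolding M_def by metis
    define e where "e = x k - p"
    have "x k \<notin> M"
      using assms k by (auto simp: M_def minimal_system_def)
    with p have e0: "e \<noteq> 0"
      by (auto simp: e_def)
    have e_orth: "ip w e = 0" if "w \<in> M" for w
      using orth[OF that] ip_eq_zero_commute by (simp add: e_def)
    have "ip (x k) e = ip e e + ip p e"
      by (simp add: e_def flip: ip_add_left)
    then have xk_e: "ip (x k) e = of_real ((norm e)\<^sup>2)"
      using e_orth[OF p] by (simp add: ip_self)
    \<comment> \<open>The normalizing factor is real, so the conjugation in the second argument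
      leaves it unchanged.\<close>
    then have "ip (x k) (smul (of_real (inverse ((norm e)\<^sup>2))) e) = 1"
      unfolding ip_smul_right conjugate_of_real xk_e of_real_mult[symmetric] using e0 by simp
    moreover have "ip (x j) (smul a e) = 0" if "j \<ge> 1" "j \<noteq> k" for j a
    proof -
      have "x j \<in> M"
        unfolding M_def using that by (intro closed_span_base) auto
      then show ?thesis
        by (simp add: ip_smul_right e_orth)
    qed
    ultimately show ?thesis
      by blast
  qed
  then obtain y where "\<And>k. k \<ge> 1 \<Longrightarrow> ip (x k) (y k) = 1 \<and> (\<forall>j\<ge>1. j \<noteq> k \<longrightarrow> ip (x j) (y k) = 0)"
    by metis
  then have "biorthogonal ip x y"
    unfolding biorthogonal_def by auto
  then show thesis
    using that by blast
qed

text \<open>The kernel of the functional given by \<open>y k\<close> is a closed subspace containing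
  every \<open>x j\<close> with \<open>j\<close> in \<open>\<sigma>\<close>.\<close>

lemma biorthogonal_vanishes_on_subsystem:
  assumes "biorthogonal ip x y" "\<sigma> \<subseteq> {1..}" "k \<ge> 1" "k \<notin> \<sigma>" "u \<in> subsystem_span smul x \<sigma>"
  shows "ip u (y k) = 0"
proof -
  have "x ` \<sigma> \<subseteq> {u. ip u (y k) = 0}"
    using assms(1-4) by (auto simp: biorthogonal_def)
  then have "subsystem_span smul x \<sigma> \<subseteq> {u. ip u (y k) = 0}"
    unfolding subsystem_span_def
    by (intro closed_span_minimal subspace_orthogonal closed_orthogonal)
  with assms(5) show ?thesis
    by blast
qed

text \<open>Finitely many indices with zero coefficient can be discarded. The map \<open>T\<close>
  subtracts the terms indexed by \<open>F\<close>; finiteness of \<open>F\<close> makes it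
  continuous, so a check on the \<open>x j\<close> extends to the whole space.\<close>

lemma cofinite_subsystem_span:
  assumes complete: "complete_system smul x" and y: "biorthogonal ip x y"
    and F: "finite F" "F \<subseteq> {1..}" and vanish: "\<And>k. k \<in> F \<Longrightarrow> ip u (y k) = 0"
  shows "u \<in> subsystem_span smul x ({1..} - F)"
proof -
  define T where "T v = v - (\<Sum>k\<in>F. smul (ip v (y k)) (x k))" for v
  have T_add: "T (v + w) = T v + T w" for v w
    by (simp add: T_def ip_add_left scale_left_distrib sum.distrib)
  have T_smul: "T (smul a v) = smul a (T v)" for a v
    by (simp add: T_def ip_smul_left scale_right_diff_distrib scale_sum_right)
  let ?N = "subsystem_span smul x ({1..} - F)"
  have sub: "subspace ?N" and cl: "closed ?N"
    by (simp_all add: subsystem_span_def subspace_closed_span closed_closed_span)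
  have T_x: "T (x j) \<in> ?N" if j: "j \<ge> 1" for j
  proof -
    \<comment> \<open>Biorthogonality leaves at most the term \<open>k = j\<close>, so
      \<open>T\<close> annihilates \<open>x j\<close> for \<open>j\<close> in \<open>F\<close> and
      fixes the other \<open>x j\<close>.\<close>
    have "(\<Sum>k\<in>F. smul (ip (x j) (y k)) (x k)) = (\<Sum>k\<in>F. if k = j then x j else 0)"
      using y F(2) j by (intro sum.cong) (auto simp: biorthogonal_def)
    then have "T (x j) = (if j \<in> F then 0 else x j)"
      using F(1) by (simp add: T_def)
    then show ?thesis
      using j subspace_0[OF sub] by (auto simp: subsystem_span_def intro!: closed_span_base)
  qed
  have "continuous_on UNIV T"
    unfolding T_def
    by (intro continuous_intros bounded_linear.continuous_on[OF bounded_linear_ip_left]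
        bounded_linear.continuous_on[OF bounded_linear_smul_left])
  with cl have "closed (T -` ?N)"
    by (rule closed_vimage)
  moreover have "subspace (T -` ?N)"
    \<comment> \<open>The instance at zero supplies \<open>T 0 = 0\<close>.\<close>
    using sub T_smul[of 0 0] by (auto simp: subspace_def T_add T_smul)
  moreover have "x ` {1..} \<subseteq> T -` ?N"
    using T_x by auto
  ultimately have "closed_span smul (x ` {1..}) \<subseteq> T -` ?N"
    by (intro closed_span_minimal)
  then have "T u \<in> ?N"
    using complete by (auto simp: complete_system_def)
  moreover have "T u = u"
    using vanish by (simp add: T_def)
  ultimately show ?thesis
    by simp
qed

section \<open>Spans with tails and the two equivalences\<close>

lemma subspace_subsystem_span: "subspace (subsystem_span smul x \<sigma>)"
  by (simp add: subsystem_span_def subspace_closed_span)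

lemma closed_subsystem_span: "closed (subsystem_span smul x \<sigma>)"
  by (simp add: subsystem_span_def closed_closed_span)

lemma subsystem_span_mono: "\<sigma> \<subseteq> \<tau> \<Longrightarrow> subsystem_span smul x \<sigma> \<subseteq> subsystem_span smul x \<tau>"
  unfolding subsystem_span_def by (intro closed_span_mono image_mono)

lemma decseq_tail_spans: "decseq (\<lambda>m. subsystem_span smul x (with_tail \<sigma> m))"
  unfolding decseq_def by (intro allI impI subsystem_span_mono) (auto simp: with_tail_def)

lemma subsystem_span_subset_tails:
  "subsystem_span smul x \<sigma> \<subseteq> (\<Inter>m\<in>A. subsystem_span smul x (with_tail \<sigma> m))"
  by (intro INT_greatest subsystem_span_mono) (simp add: with_tail_def)

lemma hereditarily_complete_iff_tail_intersection:
  assumes complete: "complete_system smul x" and minimal: "minimal_system smul x"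
  shows "hereditarily_complete smul ip x \<longleftrightarrow>
    (\<forall>\<sigma> \<subseteq> {1..}. (\<Inter>m\<in>{1..}. subsystem_span smul x (with_tail \<sigma> m)) = subsystem_span smul x \<sigma>)"
    (is "_ \<longleftrightarrow> ?tails")
proof
  assume "hereditarily_complete smul ip x"
  then obtain y where y: "biorthogonal ip x y"
    and her: "\<And>u. u \<in> closed_span smul ((\<lambda>k. smul (ip u (y k)) (x k)) ` {1..})"
    unfolding hereditarily_complete_def by blast
  have "u \<in> subsystem_span smul x \<sigma>"
    if \<sigma>: "\<sigma> \<subseteq> {1..}" and u: "u \<in> (\<Inter>m\<in>{1..}. subsystem_span smul x (with_tail \<sigma> m))" for \<sigma> u
  proof -
    have vanish: "ip u (y k) = 0" if k: "k \<ge> 1" "k \<notin> \<sigma>" for k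
    proof (rule biorthogonal_vanishes_on_subsystem[OF y])
      \<comment> \<open>The choice \<open>m = k\<close> works because the tail starts at
        \<open>k + 1\<close>, so \<open>k\<close> is missing from
        \<open>with_tail \<sigma> k\<close>.\<close>
      show "u \<in> subsystem_span smul x (with_tail \<sigma> k)"
        using u k(1) by blast
    qed (use \<sigma> k in \<open>auto simp: with_tail_def\<close>)
    have "smul (ip u (y k)) (x k) \<in> subsystem_span smul x \<sigma>" if "k \<ge> 1" for k
    proof (cases "k \<in> \<sigma>")
      case True
      then show ?thesis
        unfolding subsystem_span_def
        by (intro subspace_scale subspace_closed_span closed_span_base) simp
    next
      case False
      then show ?thesis
        using vanish[OF that] subspace_0[OF subspace_subsystem_span] by simp
    qed
    then have "closed_span smul ((\<lambda>k. smul (ip u (y k)) (x k)) ` {1..}) \<subseteq> subsystem_span smul x \<sigma>"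
      by (intro closed_span_minimal subspace_subsystem_span closed_subsystem_span) auto
    with her show ?thesis
      by blast
  qed
  then show ?tails
    by (intro allI impI subset_antisym[OF _ subsystem_span_subset_tails] subsetI)
next
  assume tails: ?tails
  obtain y where y: "biorthogonal ip x y"
    using biorthogonal_exists[OF minimal] .
  have "u \<in> closed_span smul ((\<lambda>k. smul (ip u (y k)) (x k)) ` {1..})" for u
  proof -
    define \<sigma> where "\<sigma> = {k \<in> {1..}. ip u (y k) \<noteq> 0}"
    let ?C = "closed_span smul ((\<lambda>k. smul (ip u (y k)) (x k)) ` {1..})"
    have "u \<in> subsystem_span smul x (with_tail \<sigma> m)" for m
    proof -
      \<comment> \<open>The discarded set consists of the indices up to \<open>m\<close> with zero
        coefficient; every remaining index is in \<open>\<sigma>\<close> or exceeds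
        \<open>m\<close>.\<close>
      have "u \<in> subsystem_span smul x ({1..} - ({1..m} - \<sigma>))"
        by (rule cofinite_subsystem_span[OF complete y]) (auto simp: \<sigma>_def)
      moreover have "{1..} - ({1..m} - \<sigma>) \<subseteq> with_tail \<sigma> m"
        by (auto simp: with_tail_def)
      ultimately show ?thesis
        using subsystem_span_mono by blast
    qed
    then have "u \<in> (\<Inter>m\<in>{1..}. subsystem_span smul x (with_tail \<sigma> m))"
      by blast
    also have "\<dots> = subsystem_span smul x \<sigma>"
      using tails by (simp add: \<sigma>_def subset_iff)
    finally have "u \<in> subsystem_span smul x \<sigma>" .
    also have "subsystem_span smul x \<sigma> \<subseteq> ?C"
      unfolding subsystem_span_def
    proof (intro closed_span_minimal subspace_closed_span closed_closed_span subsetI)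
      fix v assume "v \<in> x ` \<sigma>"
      then obtain k where k: "k \<ge> 1" "ip u (y k) \<noteq> 0" "v = x k"
        by (auto simp: \<sigma>_def)
      then have "smul (ip u (y k)) (x k) \<in> ?C"
        by (intro closed_span_base) auto
      \<comment> \<open>On \<open>\<sigma>\<close> the coefficient is nonzero, so dividing by it
        recovers \<open>x k\<close>.\<close>
      then have "smul (inverse (ip u (y k))) (smul (ip u (y k)) (x k)) \<in> ?C"
        by (rule subspace_scale[OF subspace_closed_span])
      with k show "v \<in> ?C"
        by simp
    qed
    finally show ?thesis .
  qed
  with y complete minimal show "hereditarily_complete smul ip x"
    unfolding hereditarily_complete_def by blast
qed

text \<open>Forward, this is convergence along a decreasing sequence of closed subspaces. Backward,
  a vector of the intersection is fixed by every projector with \<open>m \<ge> 1\<close>, hence by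
  the limit projector. The equivalence holds for each \<open>\<sigma>\<close> separately.\<close>

lemma tail_intersection_iff_projectors_tendsto:
  "(\<Inter>m\<in>{1..}. subsystem_span smul x (with_tail \<sigma> m)) = subsystem_span smul x \<sigma> \<longleftrightarrow>
    (\<forall>u. (\<lambda>m. orth_projector ip (subsystem_span smul x (with_tail \<sigma> m)) u)
      \<longlonglongrightarrow> orth_projector ip (subsystem_span smul x \<sigma>) u)"
    (is "?I = ?S \<longleftrightarrow> ?conv")
proof
  assume eq: "?I = ?S"
  \<comment> \<open>The convergence lemma intersects over all naturals, including
    \<open>m = 0\<close>. The extra set also contains \<open>?S\<close>, so the intersection is
    still \<open>?S\<close>.\<close>
  have "(\<Inter>m. subsystem_span smul x (with_tail \<sigma> m)) \<subseteq> ?I"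
    by (rule INF_superset_mono) simp_all
  then have "(\<Inter>m. subsystem_span smul x (with_tail \<sigma> m)) = ?S"
    unfolding eq by (rule subset_antisym[OF _ subsystem_span_subset_tails])
  then show ?conv
    using orth_projector_decseq_tendsto[OF subspace_subsystem_span closed_subsystem_span
        decseq_tail_spans, of x \<sigma>] by simp
next
  assume conv: ?conv
  have "u \<in> ?S" if u: "u \<in> ?I" for u
  proof -
    have "\<forall>\<^sub>F m in sequentially. orth_projector ip (subsystem_span smul x (with_tail \<sigma> m)) u = u"
      using eventually_ge_at_top[of 1]
      by eventually_elim (use u in \<open>auto intro!: orth_projector_fixed subspace_subsystem_span\<close>)
    then have "(\<lambda>m. orth_projector ip (subsystem_span smul x (with_tail \<sigma> m)) u) \<longlonglongrightarrow> u"
      by (rule tendsto_eventually)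
    then have "orth_projector ip ?S u = u"
      using conv LIMSEQ_unique by blast
    then show ?thesis
      using orth_projector_in[OF subspace_subsystem_span closed_subsystem_span] by metis
  qed
  then show "?I = ?S"
    by (intro subset_antisym[OF _ subsystem_span_subset_tails] subsetI)
qed

end

theorem corollary13:
  fixes smul :: "'k::real_or_complex \<Rightarrow> 'h::banach \<Rightarrow> 'h"
    and ip :: "'h \<Rightarrow> 'h \<Rightarrow> 'k"
    and x :: "nat \<Rightarrow> 'h"
  assumes "hilbert_space smul ip"
    and "separable_space (euclidean :: 'h topology)"
    and "complete_system smul x"
    and "minimal_system smul x"
  shows "(hereditarily_complete smul ip x \<longleftrightarrow>
            (\<forall>\<sigma> \<subseteq> {1..}. (\<Inter>m\<in>{1..}. subsystem_span smul x (with_tail \<sigma> m))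
                        = subsystem_span smul x \<sigma>))
       \<and> ((\<forall>\<sigma> \<subseteq> {1..}. (\<Inter>m\<in>{1..}. subsystem_span smul x (with_tail \<sigma> m))
                        = subsystem_span smul x \<sigma>) \<longleftrightarrow>
            (\<forall>\<sigma> \<subseteq> {1..}. \<forall>u.
               (\<lambda>m. orth_projector ip (subsystem_span smul x (with_tail \<sigma> m)) u)
                 \<longlonglongrightarrow> orth_projector ip (subsystem_span smul x \<sigma>) u))"
proof -
  interpret hilbert_space smul ip
    by (rule assms(1))
  show ?thesis
    by (rule conjI[OF hereditarily_complete_iff_tail_intersection[OF assms(3,4)]])
      (simp only: tail_intersection_iff_projectors_tendsto)
qed

end
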